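(* Let $\hat{C}=(\hat{V},\hat{N},\hat{P})$ be an abstract component with layout $\mathit{C}$. Then the algorithm Abstract-C, run on $\hat{C}$, always terminates (for every choice of the nodes and edges selected in its loops).
   Context: An abstract component with layout $\mathit{C}$ (cycle) is a directed graph $(\hat{V},\hat{N},\hat{P})$ with $\hat{V}$ a finite set of variables, $\hat{N}$ a finite set of nodes and $\hat{P}\subseteq(\hat{V}\times\hat{N})\cup(\hat{N}\times\hat{N})$. For $n\in\hat{N}$ let $P_{in}(\{n\})=\{(x,n)\in\hat{P}\mid x\in\hat{N}\setminus\{n\}\}$ and $P_{out}(\{n\})=\{(n,x)\in\hat{P}\mid x\in\hat{N}\setminus\{n\}\}$. A node $n$ is special if $(v,n)\in\hat{P}$ for some $v\in\hat{V}$, or $|P_{in}(\{n\})|>1$, or $|P_{out}(\{n\})|>1$; otherwise it is ordinary. Algorithm Abstract-C: (1) $M\leftarrow$ the set of ordinary nodes of $\hat{N}$; (2) while there are $a,b\in M$ with $a\neq b$ and $(a,b)\in\hat{P}$: (i) while there exists $(b,c)\in\hat{P}$: $\hat{P}\leftarrow(\hat{P}\setminus\{(b,c)\})\cup\{(a,c)\}$; (ii) $\hat{N}\leftarrow\hat{N}\setminus\{b\}$; (iii) $\hat{P}\leftarrow(\hat{P}\setminus\{(a,b)\})\cup\{(a,a)\}$; (iv) $M\leftarrow M\setminus\{b\}$; (3) return $(\hat{V},\hat{N},\hat{P})$. *)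

theory Defs
  imports Main
begin

text \<open>
  Variables and nodes are drawn from one common universe \<open>'a\<close>. Disjointness of the variable
  set and the node set is not required.
\<close>

locale abstract_component_C =
  fixes V :: "'a set" and N :: "'a set" and P :: "('a \<times> 'a) set"
  assumes finite_variables: "finite V"
    and finite_nodes: "finite N"
    and edges: "P \<subseteq> (V \<times> N) \<union> (N \<times> N)"

definition P_in :: "'a set \<Rightarrow> ('a \<times> 'a) set \<Rightarrow> 'a \<Rightarrow> ('a \<times> 'a) set" where
  "P_in N P n = {(x, n) | x. (x, n) \<in> P \<and> x \<in> N - {n}}"

definition P_out :: "'a set \<Rightarrow> ('a \<times> 'a) set \<Rightarrow> 'a \<Rightarrow> ('a \<times> 'a) set" where
  "P_out N P n = {(n, x) | x. (n, x) \<in> P \<and> x \<in> N - {n}}"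

definition special :: "'a set \<Rightarrow> 'a set \<Rightarrow> ('a \<times> 'a) set \<Rightarrow> 'a \<Rightarrow> bool" where
  "special V N P n \<longleftrightarrow>
     (\<exists>v\<in>V. (v, n) \<in> P) \<or> card (P_in N P n) > 1 \<or> card (P_out N P n) > 1"

definition ordinary_nodes :: "'a set \<Rightarrow> 'a set \<Rightarrow> ('a \<times> 'a) set \<Rightarrow> 'a set" where
  "ordinary_nodes V N P = {n \<in> N. \<not> special V N P n}"

text \<open>
  The algorithm as a nondeterministic small-step transition system. A configuration consists
  of a program point and the current values of the program variables, in the order \<open>V\<close>, \<open>N\<close>,
  \<open>P\<close>, \<open>M\<close>, and then, inside the body of the outer loop, the selected pair \<open>a\<close>, \<open>b\<close>.
  \<open>Inner\<close> is the head of the inner loop (i); \<open>Remove_Node\<close>, \<open>Contract_Edge\<close> and \<open>Unmark\<close> are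
  the points immediately before the assignments (ii), (iii) and (iv).
\<close>

datatype 'a config =
    Start "'a set" "'a set" "('a \<times> 'a) set"
  | Outer "'a set" "'a set" "('a \<times> 'a) set" "'a set"
  | Inner "'a set" "'a set" "('a \<times> 'a) set" "'a set" 'a 'a
  | Remove_Node "'a set" "'a set" "('a \<times> 'a) set" "'a set" 'a 'a
  | Contract_Edge "'a set" "'a set" "('a \<times> 'a) set" "'a set" 'a 'a
  | Unmark "'a set" "'a set" "('a \<times> 'a) set" "'a set" 'a 'a
  | Return "'a set" "'a set" "('a \<times> 'a) set"

inductive abstract_C_step :: "'a config \<Rightarrow> 'a config \<Rightarrow> bool" where
  init:
    "abstract_C_step (Start V N P) (Outer V N P (ordinary_nodes V N P))"
| outer_enter:
    "\<lbrakk>a \<in> M; b \<in> M; a \<noteq> b; (a, b) \<in> P\<rbrakk> \<Longrightarrow>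
     abstract_C_step (Outer V N P M) (Inner V N P M a b)"
| outer_exit:
    "\<not> (\<exists>a\<in>M. \<exists>b\<in>M. a \<noteq> b \<and> (a, b) \<in> P) \<Longrightarrow>
     abstract_C_step (Outer V N P M) (Return V N P)"
| inner_iterate:
    "(b, c) \<in> P \<Longrightarrow>
     abstract_C_step (Inner V N P M a b) (Inner V N ((P - {(b, c)}) \<union> {(a, c)}) M a b)"
| inner_exit:
    "\<not> (\<exists>c. (b, c) \<in> P) \<Longrightarrow>
     abstract_C_step (Inner V N P M a b) (Remove_Node V N P M a b)"
| remove_node:
    "abstract_C_step (Remove_Node V N P M a b) (Contract_Edge V (N - {b}) P M a b)"
| contract_edge:
    "abstract_C_step (Contract_Edge V N P M a b)
       (Unmark V N ((P - {(a, b)}) \<union> {(a, a)}) M a b)"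
| unmark:
    "abstract_C_step (Unmark V N P M a b) (Outer V N P (M - {b}))"

fun returned :: "'a config \<Rightarrow> bool" where
  "returned (Return V N P) = True"
| "returned _ = False"

text \<open>
  Termination under every resolution of the nondeterminism: there is no infinite execution,
  and an execution that cannot be continued has reached a final configuration, so that being
  stuck does not count as terminating.
\<close>

definition always_terminates :: "('s \<Rightarrow> 's \<Rightarrow> bool) \<Rightarrow> ('s \<Rightarrow> bool) \<Rightarrow> 's \<Rightarrow> bool" where
  "always_terminates step final s \<longleftrightarrow>
     \<not> (\<exists>f :: nat \<Rightarrow> 's. f 0 = s \<and> (\<forall>i. step (f i) (f (Suc i)))) \<and>
     (\<forall>t. step\<^sup>*\<^sup>* s t \<and> \<not> (\<exists>u. step t u) \<longrightarrow> final t)"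

end

theory Submission
  imports Defs
begin

text \<open>
  Every pass through the outer loop removes one node from the finite set \<open>M\<close>. Before that removal,
  each iteration of the inner loop makes an edge leaving \<open>b\<close> leave \<open>a \<noteq> b\<close> instead, so the
  out-degree of \<open>b\<close> strictly decreases, while all other steps move to a later program point. An
  execution therefore descends lexicographically in the number of marked nodes, the program point
  and the out-degree of \<open>b\<close>. It is never stuck before returning, because the guards for entering
  and leaving each loop are complementary.
\<close>

lemma always_terminatesI:
  assumes "wf R"
    and initial: "I s"
    and preserved: "\<And>t u. \<lbrakk>I t; step t u\<rbrakk> \<Longrightarrow> I u"
    and decreasing: "\<And>t u. \<lbrakk>I t; step t u\<rbrakk> \<Longrightarrow> (u, t) \<in> R"
    and progress: "\<And>t. \<lbrakk>I t; \<not> final t\<rbrakk> \<Longrightarrow> \<exists>u. step t u"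
  shows "always_terminates step final s"
  unfolding always_terminates_def
proof (intro conjI notI allI impI)
  assume "\<exists>f :: nat \<Rightarrow> _. f 0 = s \<and> (\<forall>i. step (f i) (f (Suc i)))"
  then obtain f :: "nat \<Rightarrow> _" where start: "f 0 = s" and steps: "\<And>i. step (f i) (f (Suc i))"
    by blast
  have "I (f i)" for i
    by (induction i) (use start initial steps preserved in auto)
  then have "(f (Suc i), f i) \<in> R" for i
    using steps decreasing by blast
  then show False
    using \<open>wf R\<close> unfolding wf_iff_no_infinite_down_chain by blast
next
  fix t
  assume stuck: "step\<^sup>*\<^sup>* s t \<and> (\<nexists>u. step t u)"
  then have "step\<^sup>*\<^sup>* s t" ..
  then have "I t"
    by (induction rule: rtranclp_induct) (use initial preserved in blast)+
  then show "final t"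
    using stuck progress by blast
qed

definition out_degree :: "('a \<times> 'b) set \<Rightarrow> 'a \<Rightarrow> nat" where
  "out_degree P b = card (P `` {b})"

lemma out_degree_redirect_less:
  assumes "finite (P `` {b})" "a \<noteq> b" "(b, c) \<in> P"
  shows "out_degree ((P - {(b, c)}) \<union> {(a, c)}) b < out_degree P b"
proof -
  have "((P - {(b, c)}) \<union> {(a, c)}) `` {b} = P `` {b} - {c}"
    using \<open>a \<noteq> b\<close> by auto
  moreover have "card (P `` {b} - {c}) < card (P `` {b})"
    using assms(1,3) by (intro card_Diff1_less) auto
  ultimately show ?thesis
    by (simp only: out_degree_def)
qed

fun valid_config :: "'a config \<Rightarrow> bool" where
  "valid_config (Start V N P) \<longleftrightarrow> finite N \<and> finite P"
| "valid_config (Outer V N P M) \<longleftrightarrow> finite P \<and> finite M"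
| "valid_config (Inner V N P M a b) \<longleftrightarrow> finite P \<and> finite M \<and> a \<noteq> b \<and> b \<in> M"
| "valid_config (Remove_Node V N P M a b) \<longleftrightarrow> finite P \<and> finite M \<and> b \<in> M"
| "valid_config (Contract_Edge V N P M a b) \<longleftrightarrow> finite P \<and> finite M \<and> b \<in> M"
| "valid_config (Unmark V N P M a b) \<longleftrightarrow> finite P \<and> finite M \<and> b \<in> M"
| "valid_config (Return V N P) \<longleftrightarrow> True"

fun marked_count :: "'a config \<Rightarrow> nat" where
  "marked_count (Start V N P) = card (ordinary_nodes V N P)"
| "marked_count (Outer V N P M) = card M"
| "marked_count (Inner V N P M a b) = card M"
| "marked_count (Remove_Node V N P M a b) = card M"
| "marked_count (Contract_Edge V N P M a b) = card M"
| "marked_count (Unmark V N P M a b) = card M"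
| "marked_count (Return V N P) = 0"

fun program_point_rank :: "'a config \<Rightarrow> nat" where
  "program_point_rank (Start V N P) = 5"
| "program_point_rank (Outer V N P M) = 4"
| "program_point_rank (Inner V N P M a b) = 3"
| "program_point_rank (Remove_Node V N P M a b) = 2"
| "program_point_rank (Contract_Edge V N P M a b) = 1"
| "program_point_rank (Unmark V N P M a b) = 0"
| "program_point_rank (Return V N P) = 0"

fun inner_out_degree :: "'a config \<Rightarrow> nat" where
  "inner_out_degree (Inner V N P M a b) = out_degree P b"
| "inner_out_degree _ = 0"

definition config_order :: "('a config \<times> 'a config) set" where
  "config_order = measures [marked_count, program_point_rank, inner_out_degree]"

lemma wf_config_order: "wf config_order"
  by (simp add: config_order_def)

lemma abstract_C_step_valid_config:
  assumes "valid_config s" "abstract_C_step s t"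
  shows "valid_config t"
  using assms(2,1) by cases (auto simp: ordinary_nodes_def)

lemma abstract_C_step_config_order:
  assumes "valid_config s" "abstract_C_step s t"
  shows "(t, s) \<in> config_order"
  using assms(2)
proof cases
  case (inner_iterate b c P V N M a)
  then have "out_degree ((P - {(b, c)}) \<union> {(a, c)}) b < out_degree P b"
    using \<open>valid_config s\<close> by (intro out_degree_redirect_less) auto
  then show ?thesis
    using inner_iterate by (simp add: config_order_def)
next
  case (unmark V N P M a b)
  then have "card (M - {b}) < card M"
    using \<open>valid_config s\<close> by (intro card_Diff1_less) simp_all
  then show ?thesis
    using unmark by (simp add: config_order_def)
qed (auto simp: config_order_def)

lemma abstract_C_step_progress:
  assumes "\<not> returned s"
  shows "\<exists>t. abstract_C_step s t"
proof (cases s)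
  case (Outer V N P M)
  then show ?thesis
    by (cases "\<exists>a\<in>M. \<exists>b\<in>M. a \<noteq> b \<and> (a, b) \<in> P") (blast intro: outer_enter outer_exit)+
next
  case (Inner V N P M a b)
  then show ?thesis
    by (cases "\<exists>c. (b, c) \<in> P") (blast intro: inner_iterate inner_exit)+
qed (use assms in \<open>auto intro: abstract_C_step.intros\<close>)

lemma (in abstract_component_C) finite_edges: "finite P"
  using finite_subset[OF edges] finite_variables finite_nodes by blast

theorem theorem5:
  fixes V N :: "'a set" and P :: "('a \<times> 'a) set"
  assumes "abstract_component_C V N P"
  shows "always_terminates abstract_C_step returned (Start V N P)"
proof (rule always_terminatesI)
  interpret abstract_component_C V N P by fact
  show "wf config_order"
    by (fact wf_config_order)
  show "valid_config (Start V N P)"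
    using finite_nodes finite_edges by simp
  show "valid_config t" if "valid_config s" "abstract_C_step s t" for s t :: "'a config"
    using that by (rule abstract_C_step_valid_config)
  show "(t, s) \<in> config_order" if "valid_config s" "abstract_C_step s t" for s t :: "'a config"
    using that by (rule abstract_C_step_config_order)
  show "\<exists>t. abstract_C_step s t" if "\<not> returned s" for s :: "'a config"
    using that by (rule abstract_C_step_progress)
qed

end
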